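(* Let $p\ge 6$ with $p\equiv 2\pmod 4$, let $\Gamma = I_2(p)$, $A = A(\Gamma)$ and $W = W(\Gamma)$. Then there is precisely one equivalence class of proper up-to-center-epimorphisms $A\to W$. This class is represented by $\mu': A\to W$, where $$\mu'(\sigma_1) = s_1 \quad\text{and}\quad \mu'(\sigma_2) = s_2s_1s_2.$$ In particular, since $\mu'$ is ordinary, any proper up-to-center-epimorphism $A\to W$ is ordinary.
   Context: For $\Gamma = I_2(p)$ with $p$ even, the Artin group is $A = \langle\sigma_1,\sigma_2 \mid (\sigma_1\sigma_2)^{p/2} = (\sigma_2\sigma_1)^{p/2}\rangle$ and the Coxeter group is $W = \langle s_1,s_2\mid s_1^2=s_2^2=(s_1s_2)^p=1\rangle$ (dihedral of order $2p$). Let $Z(W)$ denote the center of $W$. A homomorphism $\varphi: A\to W$ is an up-to-center-epimorphism if $W = \mathrm{Im}\,\varphi\cdot Z(W)$; it is proper if moreover it is not an epimorphism (not surjective). An up-to-center-epimorphism $\varphi$ is ordinary if $\varphi(\sigma_i^2)=1$ for $i=1,2$. Two homomorphisms $\varphi_1,\varphi_2: A\to W$ are equivalent if there is an automorphism $\alpha$ of $W$ such that $\varphi_2 = \alpha\circ\varphi_1$. *)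

theory Defs
  imports "HOL-Algebra.Coset" "HOL-Algebra.Bij"
begin

section \<open>Groups given by generators and relations\<close>

text \<open>The letter \<open>(a, True)\<close> stands for the generator \<open>a\<close>, the letter \<open>(a, False)\<close> for its inverse.
  A relation \<open>u = v\<close> is the pair \<open>(u, v)\<close>.\<close>

type_synonym 'a gword = "('a \<times> bool) list"

inductive_set word_cong :: "('a gword \<times> 'a gword) set \<Rightarrow> ('a gword \<times> 'a gword) set"
  for R :: "('a gword \<times> 'a gword) set" where
  refl: "(u, u) \<in> word_cong R"
| sym: "(u, v) \<in> word_cong R \<Longrightarrow> (v, u) \<in> word_cong R"
| trans: "(u, v) \<in> word_cong R \<Longrightarrow> (v, w) \<in> word_cong R \<Longrightarrow> (u, w) \<in> word_cong R"
| append: "(u, u') \<in> word_cong R \<Longrightarrow> (v, v') \<in> word_cong R \<Longrightarrow> (u @ v, u' @ v') \<in> word_cong R"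
| cancel: "([(a, b), (a, \<not> b)], []) \<in> word_cong R"
| relation: "(u, v) \<in> R \<Longrightarrow> (u, v) \<in> word_cong R"

definition presented_group :: "('a gword \<times> 'a gword) set \<Rightarrow> 'a gword set monoid" where
  "presented_group R =
    \<lparr>carrier = UNIV // word_cong R,
     mult = (\<lambda>X Y. \<Union>u\<in>X. \<Union>v\<in>Y. word_cong R `` {u @ v}),
     one = word_cong R `` {[]}\<rparr>"

definition presented_gen :: "('a gword \<times> 'a gword) set \<Rightarrow> 'a \<Rightarrow> 'a gword set" where
  "presented_gen R a = word_cong R `` {[(a, True)]}"

definition word_pow :: "'a gword \<Rightarrow> nat \<Rightarrow> 'a gword" where
  "word_pow w n = concat (replicate n w)"

lemma equiv_word_cong: "equiv UNIV (word_cong R)"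
  by (rule equivI) (auto intro: refl_onI symI transI word_cong.intros)

lemma presented_mult:
  "(word_cong R `` {u}) \<otimes>\<^bsub>presented_group R\<^esub> (word_cong R `` {v}) = word_cong R `` {u @ v}"
proof -
  have "word_cong R `` {u' @ v'} = word_cong R `` {u @ v}"
    if "(u, u') \<in> word_cong R" "(v, v') \<in> word_cong R" for u' v'
    using that equiv_class_eq[OF equiv_word_cong] by (metis word_cong.append)
  then have "(\<Union>u'\<in>word_cong R `` {u}. \<Union>v'\<in>word_cong R `` {v}. word_cong R `` {u' @ v'})
      = (\<Union>u'\<in>word_cong R `` {u}. \<Union>v'\<in>word_cong R `` {v}. word_cong R `` {u @ v})"
    by (intro SUP_cong HOL.refl) auto
  also have "\<dots> = word_cong R `` {u @ v}"
    using word_cong.refl[of u R] word_cong.refl[of v R] by blast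
  finally show ?thesis
    by (simp add: presented_group_def)
qed

lemma presented_one: "\<one>\<^bsub>presented_group R\<^esub> = word_cong R `` {[]}"
  by (simp add: presented_group_def)

lemma presented_class_in_carrier: "word_cong R `` {u} \<in> carrier (presented_group R)"
  by (simp add: presented_group_def quotientI)

lemma presented_carrierE:
  assumes "x \<in> carrier (presented_group R)"
  obtains u where "x = word_cong R `` {u}"
  using assms by (auto simp: presented_group_def elim: quotientE)

lemma word_cong_inverse: "(map (\<lambda>(a, b). (a, \<not> b)) (rev w) @ w, []) \<in> word_cong R"
proof (induction w)
  case Nil
  show ?case by (simp add: word_cong.refl)
next
  case (Cons l w)
  obtain a b where l: "l = (a, b)" by fastforce
  let ?i = "map (\<lambda>(a, b). (a, \<not> b)) (rev w)"
  have c: "([(a, \<not> b), (a, b)], []) \<in> word_cong R"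
    using word_cong.cancel[of a "\<not> b"] by simp
  have "(?i @ ([(a, \<not> b), (a, b)] @ w), ?i @ ([] @ w)) \<in> word_cong R"
    by (intro word_cong.append word_cong.refl c)
  then show ?case
    using Cons.IH word_cong.trans by (fastforce simp: l)
qed

lemma group_presented_group: "group (presented_group R)"
proof (rule groupI)
  fix x y assume "x \<in> carrier (presented_group R)" "y \<in> carrier (presented_group R)"
  then show "x \<otimes>\<^bsub>presented_group R\<^esub> y \<in> carrier (presented_group R)"
    by (metis presented_carrierE presented_mult presented_class_in_carrier)
next
  show "\<one>\<^bsub>presented_group R\<^esub> \<in> carrier (presented_group R)"
    by (simp add: presented_one presented_class_in_carrier)
next
  fix x y z
  assume "x \<in> carrier (presented_group R)" "y \<in> carrier (presented_group R)"
    "z \<in> carrier (presented_group R)"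
  then show "x \<otimes>\<^bsub>presented_group R\<^esub> y \<otimes>\<^bsub>presented_group R\<^esub> z
      = x \<otimes>\<^bsub>presented_group R\<^esub> (y \<otimes>\<^bsub>presented_group R\<^esub> z)"
    by (elim presented_carrierE) (simp add: presented_mult)
next
  fix x assume "x \<in> carrier (presented_group R)"
  then show "\<one>\<^bsub>presented_group R\<^esub> \<otimes>\<^bsub>presented_group R\<^esub> x = x"
    by (elim presented_carrierE) (simp add: presented_mult presented_one)
next
  fix x assume "x \<in> carrier (presented_group R)"
  then obtain w where w: "x = word_cong R `` {w}" by (rule presented_carrierE)
  have "(word_cong R `` {map (\<lambda>(a, b). (a, \<not> b)) (rev w)}) \<otimes>\<^bsub>presented_group R\<^esub> x
      = \<one>\<^bsub>presented_group R\<^esub>"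
    by (simp only: w presented_mult presented_one
        equiv_class_eq[OF equiv_word_cong word_cong_inverse])
  then show "\<exists>y\<in>carrier (presented_group R). y \<otimes>\<^bsub>presented_group R\<^esub> x = \<one>\<^bsub>presented_group R\<^esub>"
    using presented_class_in_carrier by blast
qed

section \<open>The Artin group and the Coxeter group of type I2(p)\<close>

datatype idx = I1 | I2

text \<open>The presentation below is the one for even \<open>p\<close> (for odd \<open>p\<close> the braid relation has a
  different shape).\<close>

definition artin_rels :: "nat \<Rightarrow> (idx gword \<times> idx gword) set" where
  "artin_rels p =
    {(word_pow [(I1, True), (I2, True)] (p div 2), word_pow [(I2, True), (I1, True)] (p div 2))}"

definition artin_I2 :: "nat \<Rightarrow> idx gword set monoid" where
  "artin_I2 p = presented_group (artin_rels p)"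

definition artin_gen :: "nat \<Rightarrow> idx \<Rightarrow> idx gword set" where
  "artin_gen p i = presented_gen (artin_rels p) i"

definition coxeter_rels :: "nat \<Rightarrow> (idx gword \<times> idx gword) set" where
  "coxeter_rels p =
    {([(I1, True), (I1, True)], []), ([(I2, True), (I2, True)], []),
     (word_pow [(I1, True), (I2, True)] p, [])}"

definition coxeter_I2 :: "nat \<Rightarrow> idx gword set monoid" where
  "coxeter_I2 p = presented_group (coxeter_rels p)"

definition coxeter_gen :: "nat \<Rightarrow> idx \<Rightarrow> idx gword set" where
  "coxeter_gen p i = presented_gen (coxeter_rels p) i"

section \<open>Up-to-center-epimorphisms\<close>

definition center :: "('a, 'b) monoid_scheme \<Rightarrow> 'a set" where
  "center G = {z \<in> carrier G. \<forall>g\<in>carrier G. z \<otimes>\<^bsub>G\<^esub> g = g \<otimes>\<^bsub>G\<^esub> z}"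

text \<open>The set \<^const>\<open>hom\<close> does not constrain values outside the carrier; intersecting with
  \<^const>\<open>extensional\<close> makes equality of elements coincide with equality of homomorphisms.\<close>

definition Homs :: "('a, 'c) monoid_scheme \<Rightarrow> ('b, 'd) monoid_scheme \<Rightarrow> ('a \<Rightarrow> 'b) set" where
  "Homs G H = hom G H \<inter> extensional (carrier G)"

definition up_to_center_epis ::
    "('a, 'c) monoid_scheme \<Rightarrow> ('b, 'd) monoid_scheme \<Rightarrow> ('a \<Rightarrow> 'b) set" where
  "up_to_center_epis G H =
    {\<phi> \<in> Homs G H. carrier H = (\<phi> ` carrier G) <#>\<^bsub>H\<^esub> center H}"

definition proper_up_to_center_epis ::
    "('a, 'c) monoid_scheme \<Rightarrow> ('b, 'd) monoid_scheme \<Rightarrow> ('a \<Rightarrow> 'b) set" where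
  "proper_up_to_center_epis G H = {\<phi> \<in> up_to_center_epis G H. \<phi> \<notin> epi G H}"

definition ordinary :: "nat \<Rightarrow> (idx gword set \<Rightarrow> idx gword set) \<Rightarrow> bool" where
  "ordinary p \<phi> \<longleftrightarrow>
    \<phi> \<in> up_to_center_epis (artin_I2 p) (coxeter_I2 p) \<and>
    (\<forall>i. \<phi> (artin_gen p i [^]\<^bsub>artin_I2 p\<^esub> (2::nat)) = \<one>\<^bsub>coxeter_I2 p\<^esub>)"

definition hom_equiv ::
    "('a, 'c) monoid_scheme \<Rightarrow> ('b, 'd) monoid_scheme \<Rightarrow> (('a \<Rightarrow> 'b) \<times> ('a \<Rightarrow> 'b)) set" where
  "hom_equiv G H =
    {(\<phi>1, \<phi>2). \<phi>1 \<in> Homs G H \<and> \<phi>2 \<in> Homs G H \<and>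
       (\<exists>\<alpha>\<in>auto H. \<forall>x\<in>carrier G. \<phi>2 x = \<alpha> (\<phi>1 x))}"

lemma equiv_hom_equiv:
  fixes G :: "('a, 'c) monoid_scheme" and H :: "('b, 'd) monoid_scheme"
  assumes "group H"
  shows "equiv (Homs G H) (hom_equiv G H)"
proof (rule equivI)
  interpret group H by fact
  have closed: "\<phi> x \<in> carrier H" if "\<phi> \<in> Homs G H" "x \<in> carrier G" for \<phi> x
    using that by (auto simp: Homs_def hom_def)
  show "hom_equiv G H \<subseteq> Homs G H \<times> Homs G H"
    by (auto simp: hom_equiv_def)
  show "refl_on (Homs G H) (hom_equiv G H)"
    unfolding refl_on_def hom_equiv_def
    by (auto intro!: bexI[OF _ id_in_auto] simp: closed)
  show "sym (hom_equiv G H)"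
  proof (rule symI)
    fix \<phi>1 \<phi>2 assume "(\<phi>1, \<phi>2) \<in> hom_equiv G H"
    then obtain \<alpha> where \<alpha>: "\<phi>1 \<in> Homs G H" "\<phi>2 \<in> Homs G H" "\<alpha> \<in> auto H"
      "\<And>x. x \<in> carrier G \<Longrightarrow> \<phi>2 x = \<alpha> (\<phi>1 x)"
      by (auto simp: hom_equiv_def)
    let ?\<beta> = "restrict (inv_into (carrier H) \<alpha>) (carrier H)"
    have "inj_on \<alpha> (carrier H)"
      using \<alpha>(3) by (auto simp: auto_def Bij_def bij_betw_def)
    then have "\<phi>1 x = ?\<beta> (\<phi>2 x)" if "x \<in> carrier G" for x
      using that \<alpha> closed by (metis inv_into_f_f restrict_apply)
    moreover have "?\<beta> \<in> auto H"
      using \<alpha>(3) by (simp add: auto_def restrict_inv_into_hom restrict_inv_into_Bij)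
    ultimately show "(\<phi>2, \<phi>1) \<in> hom_equiv G H"
      using \<alpha>(1,2) unfolding hom_equiv_def by blast
  qed
  show "trans (hom_equiv G H)"
  proof (rule transI)
    fix \<phi>1 \<phi>2 \<phi>3 assume "(\<phi>1, \<phi>2) \<in> hom_equiv G H" "(\<phi>2, \<phi>3) \<in> hom_equiv G H"
    then obtain \<alpha> \<beta> where h: "\<phi>1 \<in> Homs G H" "\<phi>3 \<in> Homs G H" "\<alpha> \<in> auto H" "\<beta> \<in> auto H"
      "\<And>x. x \<in> carrier G \<Longrightarrow> \<phi>3 x = \<beta> (\<alpha> (\<phi>1 x))"
      by (auto simp: hom_equiv_def)
    have "compose (carrier H) \<beta> \<alpha> \<in> auto H"
      using h(3,4) hom_compose by (auto simp: auto_def compose_Bij)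
    moreover have "\<phi>3 x = compose (carrier H) \<beta> \<alpha> (\<phi>1 x)" if "x \<in> carrier G" for x
      using that h closed by (simp add: compose_eq)
    ultimately show "(\<phi>1, \<phi>3) \<in> hom_equiv G H"
      using h(1,2) unfolding hom_equiv_def by blast
  qed
qed

end

theory Submission
  imports Defs
begin

text \<open>
  Write \<open>p = 2m\<close> with \<open>m\<close> odd. Put \<open>R i = (s\<^sub>1 s\<^sub>2)\<^sup>i\<close> and \<open>S i = R i s\<^sub>1\<close>, indexed by the integers
  modulo \<open>p\<close>, so that \<open>s\<^sub>1 = S 0\<close>, \<open>s\<^sub>2 = S (-1)\<close>, \<open>s\<^sub>2 s\<^sub>1 s\<^sub>2 = S (-2)\<close> and the center is
  \<open>{R 0, R m}\<close>. For \<open>d\<close> dividing \<open>m\<close>, the elements \<open>R i\<close> with \<open>d\<close> dividing \<open>i\<close> and \<open>S i\<close> with \<open>d\<close>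
  dividing \<open>i - j\<close> form a subgroup that contains the center, hence the image of an
  up-to-center-epimorphism lies in no such subgroup with \<open>d > 1\<close>. If exactly one generator went to
  a rotation \<open>R i\<close>, the braid relation, whose exponent \<open>m\<close> is odd, would force \<open>m\<close> to divide \<open>i\<close>,
  contradicting this with \<open>d = m\<close>. So the generators go to two reflections \<open>S i\<close> and \<open>S j\<close> with
  \<open>i - j\<close> prime to \<open>m\<close>, and properness means that \<open>i - j = 2k\<close> is even. One of \<open>k\<close> and \<open>k + m\<close> is a
  unit modulo \<open>p\<close>; multiplying indices by it and translating reflections by \<open>i\<close> is an
  automorphism that carries \<open>(S 0, S (-2))\<close> to \<open>(S i, S j)\<close>.\<close>

section \<open>Homomorphisms out of a presented group\<close>

text \<open>The value on a word of the only possible homomorphism that sends each generator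
  \<open>a\<close> to \<open>f a\<close>.\<close>

primrec word_eval :: "('b, 'c) monoid_scheme \<Rightarrow> ('a \<Rightarrow> 'b) \<Rightarrow> 'a gword \<Rightarrow> 'b" where
  "word_eval H f [] = \<one>\<^bsub>H\<^esub>"
| "word_eval H f (l # w) =
    (if snd l then f (fst l) else inv\<^bsub>H\<^esub> f (fst l)) \<otimes>\<^bsub>H\<^esub> word_eval H f w"

context group
begin

lemma word_eval_closed:
  assumes "\<And>a. f a \<in> carrier G"
  shows "word_eval G f w \<in> carrier G"
  using assms by (induction w) auto

lemma word_eval_append:
  assumes "\<And>a. f a \<in> carrier G"
  shows "word_eval G f (u @ v) = word_eval G f u \<otimes> word_eval G f v"
  using assms by (induction u) (auto simp: word_eval_closed m_assoc)

lemma word_eval_word_pow: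
  assumes "\<And>a. f a \<in> carrier G"
  shows "word_eval G f (word_pow w n) = word_eval G f w [^] n"
proof (induction n)
  case (Suc n)
  then show ?case
    using nat_pow_Suc2[of "word_eval G f w" n] word_eval_closed[of f w]
    by (simp add: word_pow_def word_eval_append assms)
qed (simp add: word_pow_def)

text \<open>Equality of values is itself a congruence on words. Cancellation holds in any group, so
  only the defining relations have to be assumed.\<close>

lemma word_eval_cong:
  assumes f: "\<And>a. f a \<in> carrier G"
    and rels: "\<And>u v. (u, v) \<in> R \<Longrightarrow> word_eval G f u = word_eval G f v"
    and "(u, v) \<in> word_cong R"
  shows "word_eval G f u = word_eval G f v"
  using assms(3)
proof induction
  case (cancel a b)
  then show ?case using f by (cases b) simp_all
qed (simp_all add: f rels word_eval_append)

text \<open>Von Dyck's theorem: generators may be sent anywhere that satisfies the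
  relations.\<close>

lemma presented_group_universal:
  assumes f: "\<And>a. f a \<in> carrier G"
    and rels: "\<And>u v. (u, v) \<in> R \<Longrightarrow> word_eval G f u = word_eval G f v"
  obtains h where "h \<in> Homs (presented_group R) G" "\<And>a. h (presented_gen R a) = f a"
proof -
  let ?P = "presented_group R"
  \<comment> \<open>Any representative will do by \<open>word_eval_cong\<close>. The restriction to
    the carrier supplies the extensionality that \<open>Homs\<close> demands.\<close>
  define h where "h = (\<lambda>X\<in>carrier ?P. word_eval G f (SOME w. w \<in> X))"
  have h: "h (word_cong R `` {u}) = word_eval G f u" for u
  proof -
    have "(SOME w. w \<in> word_cong R `` {u}) \<in> word_cong R `` {u}"
      by (rule someI[of _ u]) (simp add: word_cong.refl)
    then show ?thesis
      using word_eval_cong[OF f rels] presented_class_in_carrier[of R u]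
      by (auto simp: h_def)
  qed
  have "h \<in> hom ?P G"
  proof (rule homI)
    fix x assume "x \<in> carrier ?P"
    then show "h x \<in> carrier G"
      by (elim presented_carrierE) (simp add: h f word_eval_closed)
  next
    fix x y assume "x \<in> carrier ?P" "y \<in> carrier ?P"
    then show "h (x \<otimes>\<^bsub>?P\<^esub> y) = h x \<otimes> h y"
      by (elim presented_carrierE) (simp add: h f presented_mult word_eval_append)
  qed
  then have "h \<in> Homs ?P G"
    by (simp add: Homs_def h_def)
  moreover have "h (presented_gen R a) = f a" for a
    using f by (simp add: presented_gen_def h)
  ultimately show thesis by (rule that)
qed

end

lemma presented_gen_in_carrier: "presented_gen R a \<in> carrier (presented_group R)"
  by (simp add: presented_gen_def presented_class_in_carrier)

lemma presented_gen_inv: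
  "inv\<^bsub>presented_group R\<^esub> presented_gen R a = word_cong R `` {[(a, False)]}"
proof -
  interpret group "presented_group R" by (rule group_presented_group)
  have "([(a, False), (a, True)], []) \<in> word_cong R"
    using word_cong.cancel[of a False] by simp
  then have "(word_cong R `` {[(a, False)]}) \<otimes>\<^bsub>presented_group R\<^esub> presented_gen R a
      = \<one>\<^bsub>presented_group R\<^esub>"
    by (simp add: presented_gen_def presented_mult presented_one
        equiv_class_eq[OF equiv_word_cong])
  then show ?thesis
    by (metis inv_equality presented_gen_in_carrier presented_class_in_carrier)
qed

text \<open>Every element is a word in the generators. Hence homomorphisms are determined by their
  values on generators, and relations become equations between products.\<close>

lemma word_eval_presented_gen:
  "word_eval (presented_group R) (presented_gen R) w = word_cong R `` {w}"
proof (induction w)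
  case Nil
  then show ?case by (simp add: presented_one)
next
  case (Cons l w)
  obtain a b where "l = (a, b)" by fastforce
  then show ?case
    unfolding word_eval.simps(2) Cons.IH
    by (cases b) (simp_all add: presented_gen_inv, simp_all add: presented_gen_def presented_mult)
qed

lemma hom_word_eval:
  assumes "group G" "group H" "h \<in> hom G H" "\<And>a. f a \<in> carrier G"
  shows "h (word_eval G f w) = word_eval H (\<lambda>a. h (f a)) w"
proof -
  interpret group_hom G H h
    using assms by (simp add: group_hom_def group_hom_axioms_def)
  show ?thesis
    using assms(4) by (induction w) (simp_all add: G.word_eval_closed)
qed

lemma hom_presented_class:
  assumes "group H" "h \<in> hom (presented_group R) H"
  shows "h (word_cong R `` {w}) = word_eval H (\<lambda>a. h (presented_gen R a)) w"
  using hom_word_eval[OF group_presented_group assms, of "presented_gen R"]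
  by (simp add: word_eval_presented_gen presented_gen_in_carrier)

lemma hom_presented_image_subset:
  assumes H: "group H" and h: "h \<in> hom (presented_group R) H"
    and K: "subgroup K H" and gen: "\<And>a. h (presented_gen R a) \<in> K"
  shows "h ` carrier (presented_group R) \<subseteq> K"
proof -
  have "word_eval H (\<lambda>a. h (presented_gen R a)) w \<in> K" for w
    by (induction w)
      (simp_all add: gen subgroup.one_closed[OF K] subgroup.m_closed[OF K]
        subgroup.m_inv_closed[OF K])
  then show ?thesis
    using hom_presented_class[OF H h] by (auto elim!: presented_carrierE)
qed

lemma hom_presented_eqI:
  assumes H: "group H"
    and h: "h \<in> hom (presented_group R) H" and k: "k \<in> hom (presented_group R) H"
    and gen: "\<And>a. h (presented_gen R a) = k (presented_gen R a)"
    and x: "x \<in> carrier (presented_group R)"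
  shows "h x = k x"
  using x by (rule presented_carrierE)
    (simp add: hom_presented_class[OF H h] hom_presented_class[OF H k] gen)

section \<open>Dihedral groups in coordinates\<close>

lemma coprime_int_inverse:
  fixes u n :: int
  assumes "coprime u n"
  obtains v where "n dvd u * v - 1"
proof -
  obtain v w where "v * u + w * n = 1"
    using bezout_int[of u n] assms by (auto simp: coprime_iff_gcd_eq_1)
  then have "u * v - 1 = n * (- w)" by (simp add: algebra_simps)
  then show thesis by (intro that dvdI)
qed

text \<open>\<open>R i\<close> is a rotation and \<open>S i\<close> the reflection
  \<open>R i\<close> times \<open>S 0\<close>. Indices are integers, and only equality is taken
  modulo \<open>n\<close>, so products need no reduction of indices.\<close>

locale dihedral = group G for G (structure) +
  fixes n :: int and R S :: "int \<Rightarrow> 'a"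
  assumes carrier_eq: "carrier G = range R \<union> range S"
    and mult_RR: "R i \<otimes> R j = R (i + j)"
    and mult_RS: "R i \<otimes> S j = S (i + j)"
    and mult_SR: "S i \<otimes> R j = S (i - j)"
    and mult_SS: "S i \<otimes> S j = R (i - j)"
    and R_eq_iff: "R i = R j \<longleftrightarrow> n dvd i - j"
    and R_neq_S: "R i \<noteq> S j"
begin

lemmas mult_coords = mult_RR mult_RS mult_SR mult_SS

lemma R_closed [simp]: "R i \<in> carrier G" and S_closed [simp]: "S i \<in> carrier G"
  by (auto simp: carrier_eq)

lemma carrierE:
  assumes "x \<in> carrier G"
  obtains i where "x = R i" | i where "x = S i"
  using assms by (auto simp: carrier_eq)

lemma one_eq: "\<one> = R 0"
  by (metis R_closed add_0 l_cancel_one mult_RR)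

lemma inv_R: "inv R i = R (- i)"
  by (rule inv_equality) (simp_all add: mult_coords one_eq)

lemma inv_S: "inv S i = S i"
  by (rule inv_equality) (simp_all add: mult_coords one_eq)

lemma pow_R: "R i [^] k = R (i * int k)" for k :: nat
  by (induction k) (simp_all add: one_eq mult_coords algebra_simps)

lemma pow_S_odd:
  fixes k :: nat
  assumes "odd k"
  shows "S i [^] k = S i"
proof -
  have "S i [^] Suc (2 * b) = S i" for b
    by (induction b) (simp_all add: one_eq mult_coords)
  then show ?thesis using assms by (metis oddE Suc_eq_plus1)
qed

text \<open>Right multiplication by \<open>S 0\<close> exchanges \<open>R i\<close> and
  \<open>S i\<close>.\<close>

lemma S_eq_iff: "S i = S j \<longleftrightarrow> n dvd i - j"
proof -
  have "S i = S j \<longleftrightarrow> R i = R j"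
    by (metis add.right_neutral diff_zero mult_RS mult_SS)
  then show ?thesis by (simp add: R_eq_iff)
qed

text \<open>The subgroup generated by \<open>R d\<close> and \<open>S j\<close>; it is proper when
  \<open>d\<close> divides \<open>n\<close> and is not a unit.\<close>

definition sub :: "int \<Rightarrow> int \<Rightarrow> 'a set" where
  "sub d j = R ` {i. d dvd i} \<union> S ` {i. d dvd i - j}"

lemma S_in_sub: "d dvd i - j \<Longrightarrow> S i \<in> sub d j"
  by (auto simp: sub_def)

lemma subE:
  assumes "x \<in> sub d j"
  obtains i where "x = R i" "d dvd i" | i where "x = S i" "d dvd i - j"
  using assms by (auto simp: sub_def)

lemma subgroup_sub: "subgroup (sub d j) G"
proof (rule subgroupI)
  show "sub d j \<subseteq> carrier G" by (auto simp: sub_def)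
  show "sub d j \<noteq> {}" by (auto simp: sub_def)
next
  fix x assume "x \<in> sub d j"
  then show "inv x \<in> sub d j" by (auto simp: sub_def inv_R inv_S)
next
  fix x y assume xy: "x \<in> sub d j" "y \<in> sub d j"
  have R: "R i \<in> sub d j" if "d dvd i" for i
    using that by (auto simp: sub_def)
  show "x \<otimes> y \<in> sub d j"
    using xy(1)
  proof (cases rule: subE)
    case x: (1 i)
    from xy(2) show ?thesis
    proof (cases rule: subE)
      case (1 k)
      then show ?thesis using x dvd_add[of d i k] by (simp add: mult_coords R)
    next
      case (2 k)
      then show ?thesis
        using x dvd_add[of d i "k - j"] by (simp add: mult_coords S_in_sub algebra_simps)
    qed
  next
    case x: (2 i)
    from xy(2) show ?thesis
    proof (cases rule: subE)
      case (1 k)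
      then show ?thesis
        using x dvd_diff[of d "i - j" k] by (simp add: mult_coords S_in_sub algebra_simps)
    next
      case (2 k)
      then show ?thesis
        using x dvd_diff[of d "i - j" "k - j"] by (simp add: mult_coords R)
    qed
  qed
qed

text \<open>Since \<open>d\<close> divides \<open>n\<close>, divisibility by \<open>d\<close> does
  not depend on which index represents the rotation.\<close>

lemma R_in_sub_iff:
  assumes "d dvd n"
  shows "R i \<in> sub d j \<longleftrightarrow> d dvd i"
proof
  assume "R i \<in> sub d j"
  then show "d dvd i"
  proof (cases rule: subE)
    case (1 k)
    then have "d dvd i - k" using assms R_eq_iff dvd_trans by blast
    from dvd_add[OF this 1(2)] show ?thesis by simp
  qed (simp add: R_neq_S)
qed (auto simp: sub_def)

text \<open>Commuting with \<open>S 0\<close> forces \<open>n\<close> to divide \<open>2 * i\<close>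
  for a rotation \<open>R i\<close>. A reflection commuting with \<open>R 1\<close> would force
  \<open>n\<close> to divide 2.\<close>

lemma center_subset:
  assumes "\<not> n dvd 2"
  shows "center G \<subseteq> R ` {i. n dvd 2 * i}"
proof
  fix z assume z: "z \<in> center G"
  then have "z \<in> carrier G" and comm: "\<And>g. g \<in> carrier G \<Longrightarrow> z \<otimes> g = g \<otimes> z"
    by (auto simp: center_def)
  from this(1) show "z \<in> R ` {i. n dvd 2 * i}"
  proof (cases rule: carrierE)
    case (1 i)
    then show ?thesis using comm[of "S 0"] by (auto simp: mult_coords S_eq_iff)
  next
    case (2 i)
    then have "n dvd -2"
      using comm[of "R 1"] by (auto simp: mult_coords S_eq_iff)
    then show ?thesis using assms by simp
  qed
qed

lemma R_in_center:
  assumes "n dvd 2 * i"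
  shows "R i \<in> center G"
proof -
  have "R i \<otimes> g = g \<otimes> R i" if "g \<in> carrier G" for g
    using that assms by (elim carrierE) (auto simp: mult_coords R_eq_iff S_eq_iff algebra_simps)
  then show ?thesis by (simp add: center_def)
qed

lemma subgroup_R_mult:
  assumes K: "subgroup K G" and k: "R k \<in> K"
  shows "R (k * t) \<in> K"
proof -
  have pos: "R (k * int t) \<in> K" for t
  proof (induction t)
    case 0
    show ?case using subgroup.one_closed[OF K] by (simp add: one_eq)
  next
    case (Suc t)
    then show ?case
      using subgroup.m_closed[OF K k Suc] by (simp add: mult_coords algebra_simps)
  qed
  have neg: "R (k * - int t) \<in> K" for t
    using subgroup.m_inv_closed[OF K pos[of t]] by (simp add: inv_R)
  show ?thesis
    by (cases t rule: int_cases2) (simp_all only: pos neg)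
qed

text \<open>As \<open>k\<close> is a unit modulo \<open>n\<close>, the powers of \<open>R k\<close>
  are all rotations, and their products with \<open>S i\<close> are all reflections.\<close>

lemma subgroup_coprime_eq_carrier:
  assumes K: "subgroup K G" and k: "R k \<in> K" and i: "S i \<in> K" and "coprime k n"
  shows "K = carrier G"
proof -
  obtain v where v: "n dvd k * v - 1"
    using assms(4) by (rule coprime_int_inverse)
  have R: "R x \<in> K" for x
  proof -
    have "n dvd k * (v * x) - x"
      using dvd_mult2[OF v, of x] by (simp add: algebra_simps)
    then have "R (k * (v * x)) = R x" by (simp add: R_eq_iff)
    then show ?thesis using subgroup_R_mult[OF K k, of "v * x"] by simp
  qed
  have S: "S x \<in> K" for x
    using subgroup.m_closed[OF K R[of "x - i"] i] by (simp add: mult_coords)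
  show ?thesis
    unfolding carrier_eq using R S subgroup.subset[OF K] by (auto simp: carrier_eq)
qed

lemma subgroup_range_R: "subgroup (range R) G"
  by (rule subgroupI) (auto simp: inv_R mult_coords)

text \<open>The center consists of rotations here, so multiplying by it never produces a
  reflection.\<close>

lemma range_R_up_to_center:
  assumes "\<not> n dvd 2" "K \<subseteq> range R"
  shows "carrier G \<noteq> K <#> center G"
proof -
  have "K <#> center G \<subseteq> range R"
    using center_subset[OF assms(1)] assms(2) subgroup.m_closed[OF subgroup_range_R]
    unfolding set_mult_def by blast
  moreover have "S 0 \<notin> range R"
    using R_neq_S by (metis imageE)
  moreover have "S 0 \<in> carrier G" by simp
  ultimately show ?thesis by blast
qed

text \<open>A central \<open>R i\<close> has \<open>n\<close> dividing \<open>2 * i\<close>, hence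
  \<open>m\<close> and so \<open>d\<close> dividing \<open>i\<close>. The center thus lies in
  \<open>sub d j\<close>, and so does its product with \<open>K\<close>; containing
  \<open>R 1\<close> then means that \<open>d\<close> divides 1.\<close>

lemma sub_up_to_center:
  assumes n: "n = 2 * m" "n > 2" and "d dvd m" "K \<subseteq> sub d j"
    and eq: "carrier G = K <#> center G"
  shows "is_unit d"
proof -
  have "\<not> n dvd 2" using n zdvd_imp_le[of n 2] by auto
  moreover have "R i \<in> sub d j" if "n dvd 2 * i" for i
    using that n \<open>d dvd m\<close> by (auto simp: sub_def)
  ultimately have "center G \<subseteq> sub d j"
    using center_subset by blast
  then have "K <#> center G \<subseteq> sub d j"
    using \<open>K \<subseteq> sub d j\<close> subgroup.m_closed[OF subgroup_sub] unfolding set_mult_def by blast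
  then have "R 1 \<in> sub d j" using eq R_closed by blast
  then show ?thesis using R_in_sub_iff n \<open>d dvd m\<close> by simp
qed

text \<open>The map is affine on indices: rotations are scaled by the unit \<open>u\<close>,
  reflections are scaled and shifted by \<open>c\<close>.\<close>

lemma exists_auto:
  assumes "coprime u n"
  obtains \<alpha> where "\<alpha> \<in> auto G" "\<And>i. \<alpha> (R i) = R (u * i)" "\<And>i. \<alpha> (S i) = S (u * i + c)"
proof -
  define \<alpha> where "\<alpha> = (\<lambda>x\<in>carrier G. if x \<in> range R then R (u * inv_into UNIV R x)
    else S (u * inv_into UNIV S x + c))"
  \<comment> \<open>Read from right to left this makes the chosen index irrelevant; read from left
    to right it gives injectivity.\<close>
  have dvd: "n dvd u * i - u * j \<longleftrightarrow> n dvd i - j" for i j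
    using assms by (simp add: right_diff_distrib[symmetric] coprime_dvd_mult_right_iff coprime_commute)
  have R: "\<alpha> (R i) = R (u * i)" for i
    using f_inv_into_f[OF rangeI, of R i] by (simp add: \<alpha>_def R_eq_iff dvd rangeI)
  have "S i \<notin> range R" for i
    using R_neq_S by (metis imageE)
  then have S: "\<alpha> (S i) = S (u * i + c)" for i
    using f_inv_into_f[OF rangeI, of S i] by (simp add: \<alpha>_def S_eq_iff dvd)
  have inj: "inj_on \<alpha> (carrier G)"
  proof (rule inj_onI)
    fix x y assume "x \<in> carrier G" "y \<in> carrier G" "\<alpha> x = \<alpha> y"
    then show "x = y"
      by (elim carrierE)
        (simp_all add: R S R_eq_iff S_eq_iff R_neq_S R_neq_S[symmetric] dvd)
  qed
  \<comment> \<open>An inverse of \<open>u\<close> modulo \<open>n\<close> provides the preimages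
    for surjectivity.\<close>
  obtain v where v: "n dvd u * v - 1"
    using assms by (rule coprime_int_inverse)
  have uv: "n dvd u * (v * i) - i" for i
    using dvd_mult2[OF v, of i] by (simp add: algebra_simps)
  have "x \<in> \<alpha> ` carrier G" if "x \<in> carrier G" for x
    using that
  proof (cases rule: carrierE)
    case (1 i)
    have "\<alpha> (R (v * i)) = x" using uv 1 by (simp add: R R_eq_iff)
    then show ?thesis by (metis R_closed imageI)
  next
    case (2 i)
    have "\<alpha> (S (v * (i - c))) = x"
      using uv[of "i - c"] 2 by (simp add: S S_eq_iff algebra_simps)
    then show ?thesis by (metis S_closed imageI)
  qed
  moreover have closed: "\<alpha> x \<in> carrier G" if "x \<in> carrier G" for x
    using that by (elim carrierE) (simp_all add: R S)
  ultimately have "\<alpha> \<in> Bij (carrier G)"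
    using inj by (auto simp: Bij_def bij_betw_def \<alpha>_def)
  moreover have "\<alpha> \<in> hom G G"
  proof (rule homI)
    fix x y assume "x \<in> carrier G" "y \<in> carrier G"
    then show "\<alpha> (x \<otimes> y) = \<alpha> x \<otimes> \<alpha> y"
      by (elim carrierE) (simp_all add: R S mult_coords algebra_simps)
  qed (rule closed)
  ultimately have "\<alpha> \<in> auto G" by (simp add: auto_def)
  then show thesis using R S by (rule that)
qed

end

section \<open>Coordinates on the Coxeter group\<close>

text \<open>The hypothesis for \<open>r\<close> implies the same for \<open>inv r\<close>, so an
  induction on natural exponents, applied to both, covers all integers.\<close>

lemma (in group) int_pow_conj_inv:
  assumes "r \<in> carrier G" "s \<in> carrier G" and conj: "s \<otimes> r = inv r \<otimes> s"
  shows "s \<otimes> r [^] (i::int) = r [^] (- i) \<otimes> s"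
proof -
  have nat: "s \<otimes> x [^] (k::nat) = inv x [^] k \<otimes> s"
    if x: "x \<in> carrier G" "s \<otimes> x = inv x \<otimes> s" for x k
  proof (induction k)
    case 0
    show ?case using assms by simp
  next
    case (Suc k)
    have "s \<otimes> x [^] Suc k = inv x [^] k \<otimes> (s \<otimes> x)"
      using Suc assms x(1) by (simp add: m_assoc[symmetric])
    also have "\<dots> = inv x [^] Suc k \<otimes> s"
      using x assms by (simp add: m_assoc)
    finally show ?case .
  qed
  have "r \<otimes> (s \<otimes> r) = s"
    using assms(1,2) by (simp add: conj m_assoc[symmetric])
  then have "s \<otimes> inv r = r \<otimes> (s \<otimes> r) \<otimes> inv r" by simp
  then have conj': "s \<otimes> inv r = r \<otimes> s"
    using assms(1,2) by (simp add: m_assoc)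
  show ?thesis
  proof (cases "i \<ge> 0")
    case True
    then obtain k where "i = int k" using nonneg_int_cases by blast
    then show ?thesis
      using nat[OF assms(1) conj] assms(1) by (simp add: int_pow_neg int_pow_int nat_pow_inv)
  next
    case False
    define k where "k = nat (- i)"
    with False have "i = - int k" by simp
    then show ?thesis
      using nat[of "inv r" k] conj' assms(1)
      by (simp add: int_pow_neg int_pow_int nat_pow_inv)
  qed
qed

text \<open>The two generators act on the integers by the reflections \<open>x \<mapsto> - x\<close> and \<open>x \<mapsto> - x - 1\<close>,
  so that their product is the translation by \<open>1\<close>; modulo \<open>p\<close> this action respects the relations.\<close>

primrec refl_act :: "idx gword \<Rightarrow> int \<Rightarrow> int" where
  "refl_act [] x = x"
| "refl_act (l # w) x = (case fst l of I1 \<Rightarrow> - refl_act w x | I2 \<Rightarrow> - refl_act w x - 1)"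

lemma refl_act_append: "refl_act (u @ v) x = refl_act u (refl_act v x)"
  by (induction u) (auto split: idx.split)

lemma refl_act_pow: "refl_act (word_pow [(I1, True), (I2, True)] k) x = x + int k"
  by (induction k) (simp_all add: word_pow_def refl_act_append)

text \<open>Each letter acts by \<open>- x\<close> or \<open>- x - 1\<close>, which respects
  congruence; this lets congruences of actions be composed.\<close>

lemma refl_act_cong_arg: "n dvd x - y \<Longrightarrow> n dvd refl_act u x - refl_act u y"
proof (induction u)
  case (Cons l u)
  then have "n dvd - (refl_act u x - refl_act u y)" by (simp only: dvd_minus_iff)
  then show ?case by (auto split: idx.split)
qed simp

text \<open>The action modulo \<open>p\<close> depends only on the class of the word, which makes it
  an invariant for telling elements of the Coxeter group apart.\<close>

lemma refl_act_cong:
  "(u, v) \<in> word_cong (coxeter_rels p) \<Longrightarrow> int p dvd refl_act u x - refl_act v x"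
proof (induction arbitrary: x rule: word_cong.induct)
  case (sym u v)
  then show ?case by (simp add: dvd_diff_commute)
next
  case (trans u v w)
  from dvd_add[OF trans.IH(1)[of x] trans.IH(2)[of x]] show ?case by simp
next
  case (append u u' v v')
  have "int p dvd (refl_act u (refl_act v x) - refl_act u (refl_act v' x))
      + (refl_act u (refl_act v' x) - refl_act u' (refl_act v' x))"
    by (intro dvd_add append.IH refl_act_cong_arg)
  then show ?case by (simp add: refl_act_append)
next
  \<comment> \<open>\<open>refl_act\<close> ignores the sign of a letter, since a reflection is its
    own inverse; the case is that of a reflection applied twice.\<close>
  case (cancel a b)
  then show ?case by (cases a) simp_all
next
  case (relation u v)
  then show ?case by (auto simp: coxeter_rels_def refl_act_pow)
qed simp

section \<open>Normal forms in the Coxeter group\<close>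

lemma coxeter_gen_in_carrier: "coxeter_gen p a \<in> carrier (coxeter_I2 p)"
  by (simp add: coxeter_gen_def coxeter_I2_def presented_gen_in_carrier)

lemma word_eval_coxeter_gen:
  "word_eval (coxeter_I2 p) (coxeter_gen p) w = word_cong (coxeter_rels p) `` {w}"
  using word_eval_presented_gen[of "coxeter_rels p"]
  by (simp add: coxeter_I2_def coxeter_gen_def[abs_def])

lemma word_eval_coxeter_gen_eqI:
  assumes "(u, v) \<in> coxeter_rels p"
  shows "word_eval (coxeter_I2 p) (coxeter_gen p) u = word_eval (coxeter_I2 p) (coxeter_gen p) v"
  unfolding word_eval_coxeter_gen
  using assms by (intro equiv_class_eq[OF equiv_word_cong] word_cong.relation)

text \<open>The relations give the multiplication rules and show that nothing else is in the group.
  That the normal forms are distinct modulo \<open>p\<close> is read off from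
  \<open>refl_act\<close>.\<close>

lemma coxeter_I2_dihedral:
  assumes "p > 2"
  obtains R S where "dihedral (coxeter_I2 p) (int p) R S"
    "coxeter_gen p I1 = S 0" "coxeter_gen p I2 = S (- 1)"
proof -
  define W where "W = coxeter_I2 p"
  interpret group W by (simp add: W_def coxeter_I2_def group_presented_group)
  define s t where "s = coxeter_gen p I1" and "t = coxeter_gen p I2"
  have st [simp]: "s \<in> carrier W" "t \<in> carrier W"
    by (simp_all add: W_def s_def t_def coxeter_gen_in_carrier)
  have gens: "coxeter_gen p a \<in> carrier W" for a
    by (simp add: W_def coxeter_gen_in_carrier)
  define r where "r = s \<otimes>\<^bsub>W\<^esub> t"
  have r [simp]: "r \<in> carrier W" by (simp add: r_def)
  have ss: "s \<otimes>\<^bsub>W\<^esub> s = \<one>\<^bsub>W\<^esub>" and tt: "t \<otimes>\<^bsub>W\<^esub> t = \<one>\<^bsub>W\<^esub>"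
    using word_eval_coxeter_gen_eqI[of "[(I1, True), (I1, True)]" "[]" p]
      word_eval_coxeter_gen_eqI[of "[(I2, True), (I2, True)]" "[]" p] gens
    by (simp_all add: coxeter_rels_def W_def[symmetric] s_def t_def)
  have rp: "r [^]\<^bsub>W\<^esub> p = \<one>\<^bsub>W\<^esub>"
    using word_eval_coxeter_gen_eqI[of "word_pow [(I1, True), (I2, True)] p" "[]" p]
      word_eval_word_pow[of "coxeter_gen p"] gens
    by (simp add: coxeter_rels_def W_def[symmetric] s_def t_def r_def)
  have inv_r: "inv\<^bsub>W\<^esub> r = t \<otimes>\<^bsub>W\<^esub> s"
    using inv_mult_group[of s t] ss tt by (simp add: r_def inv_equality)
  have sr: "s \<otimes>\<^bsub>W\<^esub> r = t"
    using ss by (simp add: r_def m_assoc[symmetric])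
  then have "s \<otimes>\<^bsub>W\<^esub> r = inv\<^bsub>W\<^esub> r \<otimes>\<^bsub>W\<^esub> s"
    using ss by (simp add: inv_r m_assoc)
  then have srp: "s \<otimes>\<^bsub>W\<^esub> r [^]\<^bsub>W\<^esub> i = r [^]\<^bsub>W\<^esub> (- i) \<otimes>\<^bsub>W\<^esub> s" for i :: int
    by (intro int_pow_conj_inv) simp_all
  define R S where "R = (\<lambda>i::int. r [^]\<^bsub>W\<^esub> i)" and "S = (\<lambda>i::int. r [^]\<^bsub>W\<^esub> i \<otimes>\<^bsub>W\<^esub> s)"
  have RR: "R i \<otimes>\<^bsub>W\<^esub> R j = R (i + j)" for i j
    by (simp add: R_def int_pow_mult)
  have RS: "R i \<otimes>\<^bsub>W\<^esub> S j = S (i + j)" for i j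
    by (simp add: R_def S_def int_pow_mult m_assoc[symmetric])
  have SR: "S i \<otimes>\<^bsub>W\<^esub> R j = S (i - j)" for i j
  proof -
    have "S i \<otimes>\<^bsub>W\<^esub> R j = r [^]\<^bsub>W\<^esub> i \<otimes>\<^bsub>W\<^esub> (r [^]\<^bsub>W\<^esub> (- j) \<otimes>\<^bsub>W\<^esub> s)"
      by (simp add: R_def S_def m_assoc flip: srp)
    also have "\<dots> = S (i - j)"
      using int_pow_mult[of r i "- j"] by (simp add: S_def flip: m_assoc)
    finally show ?thesis .
  qed
  have SS: "S i \<otimes>\<^bsub>W\<^esub> S j = R (i - j)" for i j
  proof -
    have "S i \<otimes>\<^bsub>W\<^esub> S j = S i \<otimes>\<^bsub>W\<^esub> R j \<otimes>\<^bsub>W\<^esub> s"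
      by (simp add: S_def R_def m_assoc)
    also have "\<dots> = R (i - j)"
      unfolding SR using ss by (simp add: S_def R_def m_assoc)
    finally show ?thesis .
  qed
  have S0: "S 0 = s" by (simp add: S_def)
  have "R 1 = r" by (simp add: R_def)
  \<comment> \<open>The index is -1 because \<open>t = s r\<close>, that is \<open>S 0\<close> times
    \<open>R 1\<close>.\<close>
  then have S1: "S (- 1) = t"
    using SR[of 0 1] by (simp add: S0 sr)
  have closed: "R i \<in> carrier W" "S i \<in> carrier W" for i
    by (simp_all add: R_def S_def)
  have R0: "R 0 = \<one>\<^bsub>W\<^esub>" by (simp add: R_def)
  have "subgroup (range R \<union> range S) W"
  proof (rule subgroupI)
    fix x assume "x \<in> range R \<union> range S"
    moreover have "inv\<^bsub>W\<^esub> R i = R (- i)" "inv\<^bsub>W\<^esub> S i = S i" for i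
      by (rule inv_equality; simp add: closed RR SS R0)+
    ultimately show "inv\<^bsub>W\<^esub> x \<in> range R \<union> range S" by auto
  qed (auto simp: closed RR RS SR SS)
  \<comment> \<open>A subgroup containing both generators is everything: the image of the identity
    map lies in it.\<close>
  then have "(\<lambda>x. x) ` carrier W \<subseteq> range R \<union> range S"
    unfolding W_def coxeter_I2_def
  proof (rule hom_presented_image_subset[OF group_presented_group, rotated])
    fix a show "presented_gen (coxeter_rels p) a \<in> range R \<union> range S"
      using S0 S1 by (cases a) (auto simp: s_def t_def coxeter_gen_def)
  qed (auto simp: hom_def)
  then have carrier: "carrier W = range R \<union> range S"
    using closed by auto
  \<comment> \<open>A word for \<open>R i\<close> acts as translation by \<open>i\<close> modulo
    \<open>p\<close>. Reducing \<open>i\<close> modulo \<open>p\<close> makes the exponent a natural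
    number, as \<open>word_pow\<close> needs.\<close>
  have R_word: "\<exists>w. R i = word_cong (coxeter_rels p) `` {w} \<and>
    (\<forall>x. int p dvd refl_act w x - (x + i))" for i
  proof -
    define k where "k = nat (i mod int p)"
    have k: "int k = i mod int p" using assms by (simp add: k_def)
    have "R i = R (i mod int p) \<otimes>\<^bsub>W\<^esub> R (int p * (i div int p))"
      by (simp add: RR)
    also have "R (int p * (i div int p)) = \<one>\<^bsub>W\<^esub>"
      using rp by (simp add: R_def int_pow_pow[symmetric] int_pow_int)
    finally have "R i = r [^]\<^bsub>W\<^esub> k"
      by (simp add: k[symmetric] R_def int_pow_int)
    also have "\<dots> = word_eval W (coxeter_gen p) (word_pow [(I1, True), (I2, True)] k)"
      using gens by (simp add: word_eval_word_pow r_def s_def t_def)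
    finally have "R i = word_cong (coxeter_rels p) `` {word_pow [(I1, True), (I2, True)] k}"
      by (simp add: W_def word_eval_coxeter_gen)
    moreover have "int p dvd int k - i"
      unfolding k by (subst mod_eq_dvd_iff[symmetric]) simp
    ultimately show ?thesis
      by (intro exI[of _ "word_pow [(I1, True), (I2, True)] k"]) (simp add: refl_act_pow)
  qed
  have S_word: "\<exists>w. S i = word_cong (coxeter_rels p) `` {w} \<and>
    (\<forall>x. int p dvd refl_act w x - (- x + i))" for i
  proof -
    obtain w where w: "R i = word_cong (coxeter_rels p) `` {w}"
      "\<And>x. int p dvd refl_act w x - (x + i)"
      using R_word by blast
    have "S i = R i \<otimes>\<^bsub>W\<^esub> s" by (simp add: R_def S_def)
    also have "\<dots> = word_cong (coxeter_rels p) `` {w @ [(I1, True)]}"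
      unfolding w s_def W_def coxeter_gen_def coxeter_I2_def presented_gen_def
      by (rule presented_mult)
    finally show ?thesis
      using w(2)[of "- x" for x] by (intro exI[of _ "w @ [(I1, True)]"]) (simp add: refl_act_append)
  qed
  have R_eqD: "int p dvd i - j" if "R i = R j" for i j
  proof -
    obtain u where u: "R i = word_cong (coxeter_rels p) `` {u}"
      "\<And>x. int p dvd refl_act u x - (x + i)"
      using R_word by blast
    obtain v where v: "R j = word_cong (coxeter_rels p) `` {v}"
      "\<And>x. int p dvd refl_act v x - (x + j)"
      using R_word by blast
    have "(u, v) \<in> word_cong (coxeter_rels p)"
      using that unfolding u(1) v(1) by (rule eq_equiv_class[OF _ equiv_word_cong]) simp
    from dvd_diff[OF dvd_add[OF refl_act_cong[OF this, of 0] v(2)[of 0]] u(2)[of 0]]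
    show ?thesis by simp
  qed
  \<comment> \<open>A translation and a reflection that agree modulo \<open>p\<close> at both 0 and
    1 would make \<open>p\<close> divide 2.\<close>
  have neq: "R i \<noteq> S j" for i j
  proof
    assume eq: "R i = S j"
    obtain u where u: "R i = word_cong (coxeter_rels p) `` {u}"
      "\<And>x. int p dvd refl_act u x - (x + i)"
      using R_word by blast
    obtain v where v: "S j = word_cong (coxeter_rels p) `` {v}"
      "\<And>x. int p dvd refl_act v x - (- x + j)"
      using S_word by blast
    have "(u, v) \<in> word_cong (coxeter_rels p)"
      using eq unfolding u(1) v(1) by (rule eq_equiv_class[OF _ equiv_word_cong]) simp
    note c = refl_act_cong[OF this]
    have "int p dvd i - j" "int p dvd (1 + i) - (- 1 + j)"
      using dvd_diff[OF dvd_add[OF c[of 0] v(2)[of 0]] u(2)[of 0]]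
        dvd_diff[OF dvd_add[OF c[of 1] v(2)[of 1]] u(2)[of 1]]
      by (simp_all add: dvd_diff_commute algebra_simps)
    from dvd_diff[OF this(2,1)] have "int p dvd 2" by simp
    then show False using assms zdvd_imp_le[of "int p" 2] by simp
  qed
  have R_eqI: "R i = R j" if ij: "int p dvd i - j" for i j
  proof -
    obtain k where "i - j = int p * k" using ij by (rule dvdE)
    then have "i = j + int p * k" by simp
    then have "R i = R j \<otimes>\<^bsub>W\<^esub> R (int p * k)" by (simp add: RR)
    also have "R (int p * k) = \<one>\<^bsub>W\<^esub>"
      using rp by (simp add: R_def int_pow_pow[symmetric] int_pow_int)
    finally show ?thesis by (simp add: closed)
  qed
  have "dihedral W (int p) R S"
  proof unfold_locales
    show "R i = R j \<longleftrightarrow> int p dvd i - j" for i j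
      using R_eqD R_eqI by (rule iffI)
  qed (rule carrier RR RS SR SS neq)+
  then show thesis
    using that S0 S1 by (simp add: W_def s_def t_def)
qed

section \<open>The Artin group and its universal property\<close>

lemma artin_gen_in_carrier: "artin_gen p a \<in> carrier (artin_I2 p)"
  by (simp add: artin_gen_def artin_I2_def presented_gen_in_carrier)

lemma group_artin_I2: "group (artin_I2 p)"
  by (simp add: artin_I2_def group_presented_group)

lemma artin_gen_braid:
  "(artin_gen p I1 \<otimes>\<^bsub>artin_I2 p\<^esub> artin_gen p I2) [^]\<^bsub>artin_I2 p\<^esub> (p div 2)
    = (artin_gen p I2 \<otimes>\<^bsub>artin_I2 p\<^esub> artin_gen p I1) [^]\<^bsub>artin_I2 p\<^esub> (p div 2)"
proof -
  interpret group "artin_I2 p" by (rule group_artin_I2)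
  let ?u = "[(I1, True), (I2, True)]" and ?v = "[(I2, True), (I1, True)]"
  let ?e = "word_eval (artin_I2 p) (artin_gen p)"
  have eval: "?e w = word_cong (artin_rels p) `` {w}" for w
    using word_eval_presented_gen[of "artin_rels p" w]
    unfolding artin_I2_def artin_gen_def[abs_def] .
  have pow: "?e (word_pow w n) = ?e w [^]\<^bsub>artin_I2 p\<^esub> n" for w n
    by (rule word_eval_word_pow[OF artin_gen_in_carrier])
  have "(word_pow ?u (p div 2), word_pow ?v (p div 2)) \<in> artin_rels p"
    unfolding artin_rels_def by (rule singletonI)
  then have "?e (word_pow ?u (p div 2)) = ?e (word_pow ?v (p div 2))"
    unfolding eval by (intro equiv_class_eq[OF equiv_word_cong] word_cong.relation)
  moreover have "?e ?u = artin_gen p I1 \<otimes>\<^bsub>artin_I2 p\<^esub> artin_gen p I2"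
    "?e ?v = artin_gen p I2 \<otimes>\<^bsub>artin_I2 p\<^esub> artin_gen p I1"
    by (simp_all add: artin_gen_in_carrier)
  ultimately show ?thesis by (simp only: pow)
qed

lemma (in group) artin_I2_universal:
  assumes ab: "a \<in> carrier G" "b \<in> carrier G"
    and braid: "(a \<otimes> b) [^] (p div 2) = (b \<otimes> a) [^] (p div 2)"
  obtains h where "h \<in> Homs (artin_I2 p) G" "h (artin_gen p I1) = a" "h (artin_gen p I2) = b"
proof -
  let ?f = "case_idx a b"
  have f: "?f x \<in> carrier G" for x using ab by (cases x) auto
  have rels: "word_eval G ?f u = word_eval G ?f v" if "(u, v) \<in> artin_rels p" for u v
  proof -
    have "u = word_pow [(I1, True), (I2, True)] (p div 2)"
      "v = word_pow [(I2, True), (I1, True)] (p div 2)"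
      using that by (simp_all add: artin_rels_def)
    then show ?thesis using braid ab by (simp add: word_eval_word_pow f)
  qed
  show thesis
  proof (rule presented_group_universal[OF f rels])
    fix h assume "h \<in> Homs (presented_group (artin_rels p)) G"
      "\<And>x. h (presented_gen (artin_rels p) x) = ?f x"
    then show thesis by (intro that[of h]) (simp_all add: artin_I2_def artin_gen_def)
  qed
qed

lemma hom_artin_image_subset:
  assumes "group H" "h \<in> hom (artin_I2 p) H" "subgroup K H"
    and "h (artin_gen p I1) \<in> K" "h (artin_gen p I2) \<in> K"
  shows "h ` carrier (artin_I2 p) \<subseteq> K"
proof -
  have "h (presented_gen (artin_rels p) a) \<in> K" for a
    using assms(4,5) by (cases a) (simp_all add: artin_gen_def)
  then show ?thesis
    unfolding artin_I2_def
    by (rule hom_presented_image_subset[OF assms(1) assms(2)[unfolded artin_I2_def] assms(3)])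
qed

section \<open>Proper up-to-center-epimorphisms\<close>

context
  fixes p :: nat and R S :: "int \<Rightarrow> idx gword set"
  assumes p: "p \<ge> 6" "p mod 4 = 2" and dihedral: "dihedral (coxeter_I2 p) (int p) R S"
begin

interpretation W: dihedral "coxeter_I2 p" "int p" R S
  by (rule dihedral)

lemma proper_up_to_center_epi_reflections:
  assumes "\<phi> \<in> proper_up_to_center_epis (artin_I2 p) (coxeter_I2 p)"
  obtains i j where "\<phi> (artin_gen p I1) = S i" "\<phi> (artin_gen p I2) = S j"
    "even (i - j)" "coprime (i - j) (int (p div 2))"
proof -
  let ?A = "artin_I2 p" and ?W = "coxeter_I2 p"
  define m where "m = p div 2"
  have m: "int p = 2 * int m" "odd m" "int p > 2" "p = 2 * m"
    using p by (simp_all add: m_def) presburger+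
  define a b where "a = \<phi> (artin_gen p I1)" and "b = \<phi> (artin_gen p I2)"
  have hom: "\<phi> \<in> hom ?A ?W" and epi: "\<phi> ` carrier ?A \<noteq> carrier ?W"
    and center: "carrier ?W = (\<phi> ` carrier ?A) <#>\<^bsub>?W\<^esub> center ?W"
    using assms by (auto simp: proper_up_to_center_epis_def up_to_center_epis_def Homs_def epi_def)
  interpret group_hom ?A ?W \<phi>
    using group_artin_I2 hom by (simp add: group_hom_def group_hom_axioms_def W.is_group)
  have image: "\<phi> ` carrier ?A \<subseteq> K" if "subgroup K ?W" "a \<in> K" "b \<in> K" for K
    using that hom_artin_image_subset[OF W.is_group hom] by (simp add: a_def b_def)
  \<comment> \<open>Any \<open>sub d k\<close> with \<open>d\<close> dividing \<open>m\<close> that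
    contains both images contains the whole image, so \<open>d\<close> is trivial.\<close>
  have unit: "is_unit d" if "d dvd int m" "a \<in> W.sub d k" "b \<in> W.sub d k" for d k
    by (rule W.sub_up_to_center[OF m(1,3) that(1) image[OF W.subgroup_sub that(2,3)] center])
  have m_unit: "\<not> is_unit (int m)" using p by (auto simp: m_def)
  have "\<phi> ((artin_gen p I1 \<otimes>\<^bsub>?A\<^esub> artin_gen p I2) [^]\<^bsub>?A\<^esub> m)
      = \<phi> ((artin_gen p I2 \<otimes>\<^bsub>?A\<^esub> artin_gen p I1) [^]\<^bsub>?A\<^esub> m)"
    by (simp only: m_def artin_gen_braid)
  then have braid: "(a \<otimes>\<^bsub>?W\<^esub> b) [^]\<^bsub>?W\<^esub> m = (b \<otimes>\<^bsub>?W\<^esub> a) [^]\<^bsub>?W\<^esub> m"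
    by (simp add: a_def b_def hom_nat_pow artin_gen_in_carrier)
  \<comment> \<open>Both products are reflections, \<open>S (i + j)\<close> and
    \<open>S (j - i)\<close>, unchanged by the odd power \<open>m\<close>. Their equality says that
    \<open>p = 2m\<close> divides \<open>2 * i\<close>.\<close>
  have rot: "int m dvd i" if "(R i \<otimes>\<^bsub>?W\<^esub> S j) [^]\<^bsub>?W\<^esub> m = (S j \<otimes>\<^bsub>?W\<^esub> R i) [^]\<^bsub>?W\<^esub> m" for i j
  proof -
    have "int p dvd (i + j) - (j - i)"
      using that m(2) by (simp add: W.mult_coords W.pow_S_odd W.S_eq_iff)
    then show ?thesis by (simp add: m(1))
  qed
  have ab: "a \<in> carrier ?W" "b \<in> carrier ?W"
    by (simp_all add: a_def b_def artin_gen_in_carrier)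
  from ab(1) show thesis
  proof (cases rule: W.carrierE)
    case a: (1 i)
    from ab(2) show thesis
    proof (cases rule: W.carrierE)
      case (1 j)
      have "\<phi> ` carrier ?A \<subseteq> range R"
        using image[OF W.subgroup_range_R] a 1 by simp
      moreover have "\<not> int p dvd 2" using m(3) zdvd_imp_le[of "int p" 2] by auto
      ultimately show thesis using W.range_R_up_to_center center by blast
    next
      case (2 j)
      then have "int m dvd i" using rot braid a by blast
      then have "is_unit (int m)"
        using a 2 by (intro unit[of _ j]) (simp_all add: W.R_in_sub_iff W.S_in_sub m(1))
      with m_unit show thesis by simp
    qed
  next
    case a: (2 i)
    from ab(2) show thesis
    proof (cases rule: W.carrierE)
      case (1 j)
      then have "int m dvd j" using rot braid[symmetric] a by blast
      then have "is_unit (int m)"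
        using a 1 by (intro unit[of _ i]) (simp_all add: W.R_in_sub_iff W.S_in_sub m(1))
      with m_unit show thesis by simp
    next
      case b: (2 j)
      \<comment> \<open>With \<open>d\<close> this gcd, both \<open>S i\<close> and
        \<open>S j\<close> lie in \<open>sub d j\<close>.\<close>
      have "is_unit (gcd (i - j) (int m))"
        using a b by (intro unit[of _ j]) (simp_all add: W.S_in_sub)
      then have cop: "coprime (i - j) (int m)"
        by (simp add: coprime_iff_gcd_eq_1)
      have "even (i - j)"
      proof (rule ccontr)
        \<comment> \<open>An odd difference prime to \<open>m\<close> is prime to \<open>p\<close>,
          so \<open>R (i - j)\<close>, the product of the two reflections, generates all rotations
          and the map is onto.\<close>
        assume "odd (i - j)"
        then have "coprime (i - j) (int p)"
          using cop by (simp add: m(1) coprime_right_2_iff_odd)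
        moreover have S: "S i \<in> \<phi> ` carrier ?A" "S j \<in> \<phi> ` carrier ?A"
          unfolding a[symmetric] b[symmetric] a_def b_def
          by (simp_all add: artin_gen_in_carrier)
        moreover have "R (i - j) \<in> \<phi> ` carrier ?A"
          using subgroup.m_closed[OF img_is_subgroup S] by (simp add: W.mult_coords)
        ultimately have "\<phi> ` carrier ?A = carrier ?W"
          using W.subgroup_coprime_eq_carrier[OF img_is_subgroup] by blast
        with epi show False by simp
      qed
      then show thesis using that a b cop by (simp add: a_def b_def m_def)
    qed
  qed
qed

text \<open>The image consists of the elements of even index. The central \<open>R m\<close> has odd
  index, so multiplying by the center reaches the rest.\<close>

lemma reflections_proper_up_to_center_epi:
  obtains \<mu> where "\<mu> \<in> proper_up_to_center_epis (artin_I2 p) (coxeter_I2 p)"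
    "\<mu> (artin_gen p I1) = S 0" "\<mu> (artin_gen p I2) = S (- 2)"
proof -
  let ?A = "artin_I2 p" and ?W = "coxeter_I2 p"
  define m where "m = p div 2"
  have m: "int p = 2 * int m" "odd m"
    using p by (simp_all add: m_def) presburger+
  \<comment> \<open>The two sides are \<open>R (2m)\<close> and \<open>R (-2m)\<close>, both
    trivial.\<close>
  have "(S 0 \<otimes>\<^bsub>?W\<^esub> S (- 2)) [^]\<^bsub>?W\<^esub> (p div 2) = (S (- 2) \<otimes>\<^bsub>?W\<^esub> S 0) [^]\<^bsub>?W\<^esub> (p div 2)"
    unfolding m_def[symmetric] by (simp add: W.mult_coords W.pow_R W.R_eq_iff m(1))
  then obtain \<mu> where \<mu>: "\<mu> \<in> Homs ?A ?W" "\<mu> (artin_gen p I1) = S 0" "\<mu> (artin_gen p I2) = S (- 2)"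
    by (rule W.artin_I2_universal[OF W.S_closed W.S_closed])
  then have hom: "\<mu> \<in> hom ?A ?W" by (simp add: Homs_def)
  interpret group_hom ?A ?W \<mu>
    using group_artin_I2 hom by (simp add: group_hom_def group_hom_axioms_def W.is_group)
  let ?K = "\<mu> ` carrier ?A"
  have K: "subgroup ?K ?W" by (rule img_is_subgroup)
  have S: "S 0 \<in> ?K" "S (- 2) \<in> ?K"
    unfolding \<mu>(2,3)[symmetric] by (simp_all add: artin_gen_in_carrier)
  then have "R 2 \<in> ?K"
    using subgroup.m_closed[OF K S] by (simp add: W.mult_coords)
  note R2 = W.subgroup_R_mult[OF K this]
  have R_even: "R i \<in> ?K" if "even i" for i
    using that by (elim evenE) (simp only: R2)
  have S_even: "S i \<in> ?K" if "even i" for i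
    using subgroup.m_closed[OF K R_even[OF that] S(1)] by (simp add: W.mult_coords)
  have central: "R 0 \<in> center ?W" "R (int m) \<in> center ?W"
    by (simp_all add: W.R_in_center m(1))
  have prod: "x \<otimes>\<^bsub>?W\<^esub> z \<in> ?K <#>\<^bsub>?W\<^esub> center ?W" if "x \<in> ?K" "z \<in> center ?W" for x z
    using that unfolding set_mult_def by blast
  have "R i \<in> ?K <#>\<^bsub>?W\<^esub> center ?W" for i
  proof (cases "even i")
    case True
    from prod[OF R_even[OF this] central(1)] show ?thesis by (simp add: W.mult_coords)
  next
    case False
    \<comment> \<open>Write \<open>R i\<close> as \<open>R (i - m)\<close> times the central
      \<open>R m\<close>.\<close>
    then have "even (i - int m)" using m(2) by simp
    from prod[OF R_even[OF this] central(2)] show ?thesis by (simp add: W.mult_coords)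
  qed
  moreover have "S i \<in> ?K <#>\<^bsub>?W\<^esub> center ?W" for i
  proof (cases "even i")
    case True
    from prod[OF S_even[OF this] central(1)] show ?thesis by (simp add: W.mult_coords)
  next
    case False
    \<comment> \<open>The sign changes for reflections: \<open>S (i + m)\<close> times
      \<open>R m\<close> is \<open>S i\<close>.\<close>
    then have "even (i + int m)" using m(2) by simp
    from prod[OF S_even[OF this] central(2)] show ?thesis by (simp add: W.mult_coords)
  qed
  moreover have "?K <#>\<^bsub>?W\<^esub> center ?W \<subseteq> carrier ?W"
    by (rule W.set_mult_closed) (auto simp: center_def)
  ultimately have "carrier ?W = ?K <#>\<^bsub>?W\<^esub> center ?W"
    by (auto simp: W.carrier_eq)
  moreover have "\<mu> \<notin> epi ?A ?W"
  proof
    assume "\<mu> \<in> epi ?A ?W"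
    then have "R 1 \<in> ?K" by (simp add: epi_def)
    moreover have "?K \<subseteq> W.sub 2 0"
      using hom_artin_image_subset[OF W.is_group hom W.subgroup_sub] \<mu>
      by (simp add: W.S_in_sub)
    ultimately show False
      using W.R_in_sub_iff[of 2 1 0] m(1) by auto
  qed
  ultimately show thesis
    using that \<mu> by (simp add: proper_up_to_center_epis_def up_to_center_epis_def)
qed

text \<open>It suffices to find an automorphism carrying the images of the two generators under
  \<open>\<mu>\<close> to those under \<open>\<phi>\<close>.\<close>

lemma proper_up_to_center_epi_equiv:
  assumes \<mu>: "\<mu> \<in> Homs (artin_I2 p) (coxeter_I2 p)"
      "\<mu> (artin_gen p I1) = S 0" "\<mu> (artin_gen p I2) = S (- 2)"
    and \<phi>: "\<phi> \<in> proper_up_to_center_epis (artin_I2 p) (coxeter_I2 p)"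
  shows "(\<mu>, \<phi>) \<in> hom_equiv (artin_I2 p) (coxeter_I2 p)"
proof -
  let ?A = "artin_I2 p" and ?W = "coxeter_I2 p"
  define m where "m = p div 2"
  have m: "int p = 2 * int m" "odd m"
    using p by (simp_all add: m_def) presburger+
  obtain i j where ij: "\<phi> (artin_gen p I1) = S i" "\<phi> (artin_gen p I2) = S j"
    "even (i - j)" "coprime (i - j) (int m)"
    using proper_up_to_center_epi_reflections[OF \<phi>] unfolding m_def .
  obtain k where k: "i - j = 2 * k" using ij(3) by (rule evenE)
  have "coprime k (int m)" using ij(4) unfolding k by simp
  \<comment> \<open>Both choices satisfy \<open>2u = 2k\<close> modulo \<open>p\<close> and are
    prime to \<open>m\<close>. As \<open>m\<close> is odd, one of them is odd, hence prime to
    \<open>p\<close>.\<close>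
  define u where "u = (if odd k then k else k + int m)"
  have "odd u" using m(2) by (simp add: u_def)
  moreover have "coprime u (int m)"
    using \<open>coprime k (int m)\<close> by (simp add: u_def coprime_iff_gcd_eq_1)
  ultimately have u: "coprime u (int p)"
    by (simp add: m(1) coprime_right_2_iff_odd)
  show ?thesis
  proof (rule W.exists_auto[OF u, where c = i])
    fix \<alpha>
    assume \<alpha>: "\<alpha> \<in> auto ?W" "\<And>x. \<alpha> (S x) = S (u * x + i)"
    \<comment> \<open>Says that \<open>S (-2)\<close> goes to \<open>S j\<close>: the left side is
      \<open>2k - 2u\<close>, which is 0 or \<open>- p\<close>.\<close>
    have "int p dvd u * (- 2) + i - j"
      using k by (simp add: u_def m(1) algebra_simps)
    then have gens: "\<alpha> (\<mu> (artin_gen p a)) = \<phi> (artin_gen p a)" for a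
      by (cases a) (simp_all add: \<mu> ij \<alpha> W.S_eq_iff)
    have \<phi>_Homs: "\<phi> \<in> Homs ?A ?W"
      using \<phi> by (simp add: proper_up_to_center_epis_def up_to_center_epis_def)
    have "\<mu> \<in> hom ?A ?W" "\<alpha> \<in> hom ?W ?W"
      using \<mu>(1) \<alpha>(1) by (simp_all add: Homs_def auto_def)
    then have comp: "\<alpha> \<circ> \<mu> \<in> hom (presented_group (artin_rels p)) ?W"
      unfolding artin_I2_def by (rule hom_compose)
    have \<phi>_hom: "\<phi> \<in> hom (presented_group (artin_rels p)) ?W"
      using \<phi>_Homs by (simp add: Homs_def artin_I2_def)
    have "\<phi> (presented_gen (artin_rels p) a) = (\<alpha> \<circ> \<mu>) (presented_gen (artin_rels p) a)" for a
      using gens[of a] by (simp add: artin_gen_def)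
    from hom_presented_eqI[OF W.is_group \<phi>_hom comp this]
    have "\<phi> x = (\<alpha> \<circ> \<mu>) x" if "x \<in> carrier ?A" for x
      using that unfolding artin_I2_def .
    then have "\<forall>x\<in>carrier ?A. \<phi> x = \<alpha> (\<mu> x)" by simp
    with \<mu>(1) \<phi>_Homs \<alpha>(1) show ?thesis
      by (auto simp: hom_equiv_def)
  qed
qed

lemma proper_up_to_center_epi_ordinary:
  assumes \<phi>: "\<phi> \<in> proper_up_to_center_epis (artin_I2 p) (coxeter_I2 p)"
  shows "ordinary p \<phi>"
proof -
  have up: "\<phi> \<in> up_to_center_epis (artin_I2 p) (coxeter_I2 p)"
    using \<phi> by (simp add: proper_up_to_center_epis_def)
  then have "\<phi> \<in> hom (artin_I2 p) (coxeter_I2 p)"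
    by (simp add: up_to_center_epis_def Homs_def)
  then interpret group_hom "artin_I2 p" "coxeter_I2 p" \<phi>
    using group_artin_I2 by (simp add: group_hom_def group_hom_axioms_def W.is_group)
  obtain i j where ij: "\<phi> (artin_gen p I1) = S i" "\<phi> (artin_gen p I2) = S j"
    by (rule proper_up_to_center_epi_reflections[OF \<phi>])
  have "\<phi> (artin_gen p a [^]\<^bsub>artin_I2 p\<^esub> (2::nat)) = \<one>\<^bsub>coxeter_I2 p\<^esub>" for a
    by (cases a) (simp_all add: hom_nat_pow artin_gen_in_carrier ij numeral_2_eq_2
        W.mult_coords W.one_eq)
  then show ?thesis using up by (simp add: ordinary_def)
qed

end

theorem proposition2p3:
  fixes p :: nat
  assumes "p \<ge> 6" and "p mod 4 = 2"
  defines "A \<equiv> artin_I2 p" and "W \<equiv> coxeter_I2 p"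
  defines "P \<equiv> proper_up_to_center_epis A W" and "E \<equiv> hom_equiv A W"
  shows "(\<exists>!C. C \<in> P // E) \<and>
    (\<exists>\<mu>'\<in>P. \<mu>' (artin_gen p I1) = coxeter_gen p I1 \<and>
       \<mu>' (artin_gen p I2) = coxeter_gen p I2 \<otimes>\<^bsub>W\<^esub> coxeter_gen p I1 \<otimes>\<^bsub>W\<^esub> coxeter_gen p I2 \<and>
       P // E = {E `` {\<mu>'}} \<and>
       ordinary p \<mu>') \<and>
    (\<forall>\<phi>\<in>P. ordinary p \<phi>)"
proof -
  have "p > 2" using assms(1) by simp
  then obtain R S where D: "dihedral (coxeter_I2 p) (int p) R S"
    and gens: "coxeter_gen p I1 = S 0" "coxeter_gen p I2 = S (- 1)"
    by (rule coxeter_I2_dihedral)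
  interpret dihedral W "int p" R S
    unfolding W_def by (rule D)
  obtain \<mu> where \<mu>: "\<mu> \<in> P" "\<mu> (artin_gen p I1) = S 0" "\<mu> (artin_gen p I2) = S (- 2)"
    using reflections_proper_up_to_center_epi[OF assms(1,2) D] unfolding P_def A_def W_def .
  have P_Homs: "P \<subseteq> Homs A W"
    by (auto simp: P_def proper_up_to_center_epis_def up_to_center_epis_def)
  \<comment> \<open>\<open>E\<close> is an equivalence on all homomorphisms, so being related to
    \<open>\<mu>\<close> makes the full classes equal.\<close>
  have "E `` {\<phi>} = E `` {\<mu>}" if "\<phi> \<in> P" for \<phi>
  proof -
    have "(\<mu>, \<phi>) \<in> E"
      using subsetD[OF P_Homs \<mu>(1)] that unfolding P_def A_def W_def E_def
      by (intro proper_up_to_center_epi_equiv[OF assms(1,2) D _ \<mu>(2,3)])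
    then show ?thesis
      unfolding E_def by (rule equiv_class_eq[OF equiv_hom_equiv[OF is_group], symmetric])
  qed
  then have quot: "P // E = {E `` {\<mu>}}"
    using \<mu>(1) unfolding quotient_def by blast
  have ord: "\<forall>\<phi>\<in>P. ordinary p \<phi>"
    using proper_up_to_center_epi_ordinary[OF assms(1,2) D] unfolding P_def A_def W_def by blast
  \<comment> \<open>In coordinates, \<open>S (-1)\<close> times \<open>S 0\<close> is
    \<open>R (-1)\<close>, and this times \<open>S (-1)\<close> is \<open>S (-2)\<close>.\<close>
  have "\<mu> (artin_gen p I2) = coxeter_gen p I2 \<otimes>\<^bsub>W\<^esub> coxeter_gen p I1 \<otimes>\<^bsub>W\<^esub> coxeter_gen p I2"
    by (simp add: \<mu> gens mult_coords)
  then have "\<exists>\<mu>'\<in>P. \<mu>' (artin_gen p I1) = coxeter_gen p I1 \<and>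
       \<mu>' (artin_gen p I2) = coxeter_gen p I2 \<otimes>\<^bsub>W\<^esub> coxeter_gen p I1 \<otimes>\<^bsub>W\<^esub> coxeter_gen p I2 \<and>
       P // E = {E `` {\<mu>'}} \<and>
       ordinary p \<mu>'"
    using \<mu>(1,2) gens(1) quot ord by (intro bexI[of _ \<mu>] conjI) simp_all
  moreover have "\<exists>!C. C \<in> P // E" using quot by simp
  ultimately show ?thesis using ord by blast
qed

end
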